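(* Let $G$ be a graph with $n$ vertices, maximum degree $\Delta$ and minimum degree $\delta$. Let $\lambda_1$ be the largest eigenvalue of the adjacency matrix $A(G)$ and $\rho_1$ the largest eigenvalue of the Sombor matrix $\mathcal{S}(G)$. Then $$\sqrt{2}\,\delta\,\lambda_1\leq \rho_1 \leq \sqrt{2}\,\Delta\,\lambda_1,$$ with equality if and only if $G$ is a regular graph.
   Context: $G$ is a simple undirected graph with vertex set $\{v_1,\dots,v_n\}$; $d_i$ denotes the degree of $v_i$. The Sombor matrix $\mathcal{S}(G)$ is the $n\times n$ matrix whose $(i,j)$-entry is $\sqrt{d_i^2+d_j^2}$ if $v_i$ and $v_j$ are adjacent and $0$ otherwise. Its eigenvalues are $\rho_1\ge\rho_2\ge\cdots\ge\rho_n$.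
   Formalization: The claim that equality in the upper bound alone forces G to be regular is stated only for connected G, since it fails for the disjoint union of K_3 and K_2; the bounds, equality in the lower bound, and equality throughout are characterized for all graphs. *)

theory Defs
  imports "HOL-Analysis.Analysis"
begin

text \<open>
  A graph on \<open>n = CARD('n)\<close> vertices is given by its adjacency relation on the vertex
  type \<open>'n\<close>; since types are inhabited, \<open>n \<ge> 1\<close>.
\<close>

definition simple_graph :: "('n::finite \<Rightarrow> 'n \<Rightarrow> bool) \<Rightarrow> bool" where
  "simple_graph E \<longleftrightarrow> symp E \<and> irreflp E"

definition vertex_degree :: "('n::finite \<Rightarrow> 'n \<Rightarrow> bool) \<Rightarrow> 'n \<Rightarrow> nat" where
  "vertex_degree E v = card {w. E v w}"

definition max_degree :: "('n::finite \<Rightarrow> 'n \<Rightarrow> bool) \<Rightarrow> nat" where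
  "max_degree E = Max (range (vertex_degree E))"

definition min_degree :: "('n::finite \<Rightarrow> 'n \<Rightarrow> bool) \<Rightarrow> nat" where
  "min_degree E = Min (range (vertex_degree E))"

definition regular_graph :: "('n::finite \<Rightarrow> 'n \<Rightarrow> bool) \<Rightarrow> bool" where
  "regular_graph E \<longleftrightarrow> (\<exists>k. \<forall>v. vertex_degree E v = k)"

definition connected_graph :: "('n::finite \<Rightarrow> 'n \<Rightarrow> bool) \<Rightarrow> bool" where
  "connected_graph E \<longleftrightarrow> (\<forall>u v. E\<^sup>*\<^sup>* u v)"

definition adjacency_matrix :: "('n::finite \<Rightarrow> 'n \<Rightarrow> bool) \<Rightarrow> real ^ 'n ^ 'n" where
  "adjacency_matrix E = (\<chi> i j. if E i j then 1 else 0)"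

definition sombor_matrix :: "('n::finite \<Rightarrow> 'n \<Rightarrow> bool) \<Rightarrow> real ^ 'n ^ 'n" where
  "sombor_matrix E =
    (\<chi> i j. if E i j then sqrt ((real (vertex_degree E i))\<^sup>2 + (real (vertex_degree E j))\<^sup>2) else 0)"

definition eigenvalue :: "real ^ 'n ^ 'n \<Rightarrow> real \<Rightarrow> bool" where
  "eigenvalue A c \<longleftrightarrow> (\<exists>x. x \<noteq> 0 \<and> A *v x = c *\<^sub>R x)"

text \<open>
  Used only for real symmetric matrices, whose set of eigenvalues is finite and nonempty
  and contains all complex eigenvalues.
\<close>

definition largest_eigenvalue :: "real ^ 'n ^ 'n \<Rightarrow> real" where
  "largest_eigenvalue A = Max {c. eigenvalue A c}"

end

theory Submission
  imports Defs
begin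

text \<open>
  For symmetric matrices the largest eigenvalue is the maximum of the Rayleigh quotient, and for
  entrywise nonnegative ones it is attained at a nonnegative vector; hence it is monotone in the
  entries. The bounds follow from \<open>\<surd>2 \<delta> A \<le> S \<le> \<surd>2 \<Delta> A\<close> entrywise.

  If the lower bound is attained, every edge inside the support of a nonnegative top eigenvector
  \<open>x\<close> of \<open>A\<close> joins vertices of degree \<open>\<delta>\<close>. Looking at a largest entry of \<open>x\<close> gives
  \<open>\<lambda>\<^sub>1 \<le> \<delta>\<close>, while \<open>\<lambda>\<^sub>1\<close> is at least the average degree, so all degrees equal \<open>\<delta>\<close>. If the
  upper bound is attained and the graph is connected, a nonnegative top eigenvector of \<open>S\<close> has no
  zero entry, so every edge joins vertices of degree \<open>\<Delta>\<close>.
\<close>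

section \<open>The largest eigenvalue of a symmetric matrix\<close>

lemma inner_matrix_vector_sum:
  fixes A :: "real ^ 'n ^ 'n"
  shows "x \<bullet> (A *v x) = (\<Sum>i\<in>UNIV. \<Sum>j\<in>UNIV. A $ i $ j * (x $ i * x $ j))"
  by (simp add: inner_vec_def matrix_vector_mult_def sum_distrib_left ac_simps)

lemma symmetric_inner_commute:
  fixes A :: "real ^ 'n ^ 'n"
  assumes "transpose A = A"
  shows "x \<bullet> (A *v y) = (A *v x) \<bullet> y"
  by (metis assms dot_lmul_matrix transpose_matrix_vector)

text \<open>First-order condition at a maximizer. The form
  \<open>M * (y \<bullet> y) - y \<bullet> (A *v y)\<close> is nonnegative and vanishes at
  \<open>x\<close>; along the residual \<open>z\<close> its linear term is
  \<open>2 * t * (z \<bullet> z)\<close>, so a small negative \<open>t\<close> would make it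
  negative unless \<open>z = 0\<close>.\<close>

lemma rayleigh_maximizer_eigenvector:
  fixes A :: "real ^ 'n ^ 'n"
  assumes sym: "transpose A = A"
    and bound: "\<And>y. y \<bullet> (A *v y) \<le> M * (y \<bullet> y)"
    and eq: "x \<bullet> (A *v x) = M * (x \<bullet> x)"
  shows "A *v x = M *\<^sub>R x"
proof -
  define z where "z = M *\<^sub>R x - A *v x"
  define a where "a = z \<bullet> z"
  define b where "b = M * (z \<bullet> z) - z \<bullet> (A *v z)"
  have b: "b \<ge> 0" using bound[of z] by (simp add: b_def)
  have q: "2 * t * a + t\<^sup>2 * b \<ge> 0" for t
  proof -
    have c: "x \<bullet> (A *v z) = z \<bullet> (A *v x)"
      using symmetric_inner_commute[OF sym, of x z] by (simp add: inner_commute)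
    have a: "a = M * (z \<bullet> x) - z \<bullet> (A *v x)"
      unfolding a_def by (subst (2) z_def) (simp add: inner_diff_right)
    have "M * ((x + t *\<^sub>R z) \<bullet> (x + t *\<^sub>R z)) - (x + t *\<^sub>R z) \<bullet> (A *v (x + t *\<^sub>R z))
        = (M * (x \<bullet> x) - x \<bullet> (A *v x)) + 2 * t * a + t\<^sup>2 * b"
      by (simp add: a b_def c inner_add_left inner_add_right matrix_vector_right_distrib
          matrix_vector_mult_scaleR inner_commute[of x z] power2_eq_square algebra_simps)
    then show ?thesis using bound[of "x + t *\<^sub>R z"] eq by simp
  qed
  \<comment> \<open>Dividing by \<open>b + 1\<close> rather than \<open>b\<close> also covers
    \<open>b = 0\<close>, and the quadratic in \<open>t\<close> becomes
    \<open>- (t^2 * (b + 2))\<close>.\<close>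
  define t where "t = - a / (b + 1)"
  have a_t: "a = - (b + 1) * t" using b by (simp add: t_def field_simps)
  have "2 * t * a + t\<^sup>2 * b = - (t\<^sup>2 * (b + 2))"
    by (simp add: a_t algebra_simps power2_eq_square)
  then have "t\<^sup>2 * (b + 2) \<le> 0" using q[of t] by simp
  then have "a = 0" using b by (simp add: a_t mult_le_0_iff)
  then show ?thesis by (simp add: a_def z_def)
qed

text \<open>Eigenvectors for distinct eigenvalues are orthogonal, hence independent. Finiteness
  gives the \<open>Max\<close> in \<open>largest_eigenvalue\<close> its meaning.\<close>

lemma finite_eigenvalues_symmetric:
  fixes A :: "real ^ 'n ^ 'n"
  assumes sym: "transpose A = A"
  shows "finite {c. eigenvalue A c}"
proof -
  define v where "v c = (SOME x. x \<noteq> 0 \<and> A *v x = c *\<^sub>R x)" for c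
  have v: "v c \<noteq> 0 \<and> A *v v c = c *\<^sub>R v c" if "eigenvalue A c" for c
    using that unfolding eigenvalue_def v_def by (rule someI_ex)
  have orth: "v c \<bullet> v d = 0" if "eigenvalue A c" "eigenvalue A d" "c \<noteq> d" for c d
  proof -
    have "d * (v c \<bullet> v d) = c * (v c \<bullet> v d)"
      using symmetric_inner_commute[OF sym, of "v c" "v d"] v[OF that(1)] v[OF that(2)] by simp
    then show ?thesis using that(3) by simp
  qed
  \<comment> \<open>An eigenvector shared by two eigenvalues would be orthogonal to itself, hence
    zero.\<close>
  have inj: "inj_on v {c. eigenvalue A c}"
    by (rule inj_onI) (metis inner_eq_zero_iff mem_Collect_eq orth v)
  have "independent (v ` {c. eigenvalue A c})"
  proof (rule pairwise_orthogonal_independent)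
    show "pairwise orthogonal (v ` {c. eigenvalue A c})"
      using orth by (fastforce simp: pairwise_def orthogonal_def)
    show "0 \<notin> v ` {c. eigenvalue A c}" using v by force
  qed
  then have "finite (v ` {c. eigenvalue A c})" by (rule finiteI_independent)
  then show ?thesis using inj by (rule finite_imageD)
qed

text \<open>An attained bound on the Rayleigh quotient is an eigenvalue, and every eigenvalue is the
  quotient at its own eigenvector, so none exceeds it.\<close>

lemma largest_eigenvalue_eqI:
  fixes A :: "real ^ 'n ^ 'n"
  assumes sym: "transpose A = A"
    and bound: "\<And>y. y \<bullet> (A *v y) \<le> M * (y \<bullet> y)"
    and x: "x \<noteq> 0" "x \<bullet> (A *v x) = M * (x \<bullet> x)"
  shows "largest_eigenvalue A = M"
  unfolding largest_eigenvalue_def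
proof (rule Max_eqI)
  show "finite {c. eigenvalue A c}" by (rule finite_eigenvalues_symmetric[OF sym])
  show "M \<in> {c. eigenvalue A c}"
    using rayleigh_maximizer_eigenvector[OF sym bound x(2)] x(1) by (auto simp: eigenvalue_def)
next
  fix c assume "c \<in> {c. eigenvalue A c}"
  then obtain y where y: "y \<noteq> 0" "A *v y = c *\<^sub>R y" by (auto simp: eigenvalue_def)
  then show "c \<le> M" using bound[of y] by simp
qed

text \<open>Compactness of the unit sphere gives the maximum; homogeneity of degree 2 carries the
  bound to all vectors.\<close>

lemma rayleigh_maximum_exists:
  fixes A :: "real ^ 'n ^ 'n"
  obtains x M where "x \<noteq> 0" "x \<bullet> (A *v x) = M * (x \<bullet> x)"
    "\<And>y. y \<bullet> (A *v y) \<le> M * (y \<bullet> y)"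
proof -
  have "continuous_on (sphere 0 1) (\<lambda>y. y \<bullet> (A *v y))"
    by (intro continuous_intros linear_continuous_on) (simp add: linear_linear[symmetric])
  moreover have "sphere (0 :: real ^ 'n) 1 \<noteq> {}" by simp
  ultimately obtain x where x: "x \<in> sphere 0 1"
    and max: "\<And>y. y \<in> sphere 0 1 \<Longrightarrow> y \<bullet> (A *v y) \<le> x \<bullet> (A *v x)"
    using continuous_attains_sup[OF compact_sphere, of 0 1 "\<lambda>y. y \<bullet> (A *v y)"] by blast
  show thesis
  proof
    show "x \<noteq> 0" using x by auto
    show "x \<bullet> (A *v x) = (x \<bullet> (A *v x)) * (x \<bullet> x)"
      using x by (simp add: norm_eq_1)
    fix y :: "real ^ 'n"
    show "y \<bullet> (A *v y) \<le> (x \<bullet> (A *v x)) * (y \<bullet> y)"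
    proof (cases "y = 0")
      case False
      define u where "u = y /\<^sub>R norm y"
      have y: "y = norm y *\<^sub>R u" using False by (simp add: u_def)
      have "u \<in> sphere 0 1" using False by (simp add: u_def)
      then have "u \<bullet> (A *v u) \<le> x \<bullet> (A *v x)" by (rule max)
      then have "(norm y)\<^sup>2 * (u \<bullet> (A *v u)) \<le> (norm y)\<^sup>2 * (x \<bullet> (A *v x))"
        by (rule mult_left_mono) simp
      moreover have "y \<bullet> (A *v y) = (norm y)\<^sup>2 * (u \<bullet> (A *v u))"
        using arg_cong[OF y, of "\<lambda>y. y \<bullet> (A *v y)"]
        by (simp add: matrix_vector_mult_scaleR power2_eq_square)
      ultimately show ?thesis by (simp add: power2_norm_eq_inner mult.commute)
    qed simp
  qed
qed

lemma rayleigh_le_largest_eigenvalue: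
  fixes A :: "real ^ 'n ^ 'n"
  assumes "transpose A = A"
  shows "y \<bullet> (A *v y) \<le> largest_eigenvalue A * (y \<bullet> y)"
proof -
  obtain x M where x: "x \<noteq> 0" "x \<bullet> (A *v x) = M * (x \<bullet> x)"
    and bound: "\<And>y. y \<bullet> (A *v y) \<le> M * (y \<bullet> y)"
    by (rule rayleigh_maximum_exists[of A]) blast
  have "largest_eigenvalue A = M" by (rule largest_eigenvalue_eqI[OF assms bound x])
  then show ?thesis using bound by simp
qed

section \<open>Nonnegative symmetric matrices\<close>

text \<open>The weak Perron-Frobenius statement: taking absolute values of the entries of a
  maximizer keeps its norm and cannot decrease the form, so the result is again a maximizer.\<close>

lemma nonneg_top_eigenvector:
  fixes A :: "real ^ 'n ^ 'n"
  assumes sym: "transpose A = A" and nonneg: "\<And>i j. A $ i $ j \<ge> 0"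
  obtains x where "x \<noteq> 0" "\<And>i. x $ i \<ge> 0" "A *v x = largest_eigenvalue A *\<^sub>R x"
proof -
  obtain y M where y: "y \<noteq> 0" "y \<bullet> (A *v y) = M * (y \<bullet> y)"
    and bound: "\<And>z. z \<bullet> (A *v z) \<le> M * (z \<bullet> z)"
    by (rule rayleigh_maximum_exists[of A]) blast
  have M: "largest_eigenvalue A = M" by (rule largest_eigenvalue_eqI[OF sym bound y])
  define x where "x = (\<chi> i. \<bar>y $ i\<bar>)"
  have xx: "x \<bullet> x = y \<bullet> y" by (simp add: x_def inner_vec_def)
  have "y \<bullet> (A *v y) \<le> x \<bullet> (A *v x)"
    unfolding inner_matrix_vector_sum x_def
    by (intro sum_mono mult_left_mono nonneg) (simp add: abs_mult[symmetric])
  then have eq: "x \<bullet> (A *v x) = M * (x \<bullet> x)"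
    using bound[of x] y(2) xx by simp
  show thesis
  proof
    show "x \<noteq> 0" using y(1) xx by auto
    show "x $ i \<ge> 0" for i by (simp add: x_def)
    show "A *v x = largest_eigenvalue A *\<^sub>R x"
      unfolding M by (rule rayleigh_maximizer_eigenvector[OF sym bound eq])
  qed
qed

lemma largest_eigenvalue_scaleR:
  fixes A :: "real ^ 'n ^ 'n"
  assumes sym: "transpose A = A" and c: "c \<ge> 0"
  shows "largest_eigenvalue (c *\<^sub>R A) = c * largest_eigenvalue A"
proof -
  obtain x M where x: "x \<noteq> 0" "x \<bullet> (A *v x) = M * (x \<bullet> x)"
    and bound: "\<And>y. y \<bullet> (A *v y) \<le> M * (y \<bullet> y)"
    by (rule rayleigh_maximum_exists[of A]) blast
  have M: "largest_eigenvalue A = M" by (rule largest_eigenvalue_eqI[OF sym bound x])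
  show ?thesis unfolding M
  proof (rule largest_eigenvalue_eqI[OF _ _ x(1)])
    show "transpose (c *\<^sub>R A) = c *\<^sub>R A" by (simp add: transpose_scalar sym)
    show "y \<bullet> (c *\<^sub>R A *v y) \<le> c * M * (y \<bullet> y)" for y
      using mult_left_mono[OF bound[of y] c]
      by (simp add: scaleR_matrix_vector_assoc[symmetric] mult.assoc)
    show "x \<bullet> (c *\<^sub>R A *v x) = c * M * (x \<bullet> x)"
      by (simp add: scaleR_matrix_vector_assoc[symmetric] x(2))
  qed
qed

text \<open>A nonnegative top eigenvector of \<open>A\<close> serves as test vector for
  \<open>B\<close>: the weights \<open>x $ i * x $ j\<close> are nonnegative, so the forms compare
  term by term.\<close>

lemma largest_eigenvalue_mono:
  fixes A B :: "real ^ 'n ^ 'n"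
  assumes symA: "transpose A = A" and symB: "transpose B = B"
    and nonneg: "\<And>i j. A $ i $ j \<ge> 0" and le: "\<And>i j. A $ i $ j \<le> B $ i $ j"
  shows "largest_eigenvalue A \<le> largest_eigenvalue B"
proof -
  obtain x where x: "x \<noteq> 0" "\<And>i. x $ i \<ge> 0" "A *v x = largest_eigenvalue A *\<^sub>R x"
    by (rule nonneg_top_eigenvector[OF symA nonneg]) blast
  have "largest_eigenvalue A * (x \<bullet> x) = x \<bullet> (A *v x)" by (simp add: x(3))
  also have "\<dots> \<le> x \<bullet> (B *v x)"
    unfolding inner_matrix_vector_sum by (intro sum_mono mult_right_mono le) (simp add: x(2))
  also have "\<dots> \<le> largest_eigenvalue B * (x \<bullet> x)" by (rule rayleigh_le_largest_eigenvalue[OF symB])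
  finally show ?thesis using x(1) by simp
qed

text \<open>Equality makes the form of \<open>B - A\<close> at \<open>x\<close> nonpositive, while
  each of its summands is nonnegative; so every summand vanishes.\<close>

lemma largest_eigenvalue_eq_imp_entries_eq:
  fixes A B :: "real ^ 'n ^ 'n"
  assumes symB: "transpose B = B" and le: "\<And>i j. A $ i $ j \<le> B $ i $ j"
    and eq: "largest_eigenvalue A = largest_eigenvalue B"
    and x: "\<And>i. x $ i \<ge> 0" "A *v x = largest_eigenvalue A *\<^sub>R x"
    and pos: "x $ i > 0" "x $ j > 0"
  shows "A $ i $ j = B $ i $ j"
proof -
  let ?d = "\<lambda>i j. (B $ i $ j - A $ i $ j) * (x $ i * x $ j)"
  have d: "?d i j \<ge> 0" for i j using le[of i j] x(1) by simp
  have "(\<Sum>i\<in>UNIV. \<Sum>j\<in>UNIV. ?d i j) = x \<bullet> (B *v x) - x \<bullet> (A *v x)"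
    unfolding inner_matrix_vector_sum by (simp add: left_diff_distrib sum_subtractf)
  also have "\<dots> \<le> 0"
    using rayleigh_le_largest_eigenvalue[OF symB, of x] by (simp add: x(2) eq)
  finally have "(\<Sum>i\<in>UNIV. \<Sum>j\<in>UNIV. ?d i j) = 0"
    by (intro antisym sum_nonneg d)
  then have "?d i j = 0"
    by (simp add: sum_nonneg_eq_0_iff sum_nonneg d del: mult_eq_0_iff)
  then show ?thesis using pos by simp
qed

section \<open>Adjacency and Sombor matrices\<close>

lemma transpose_adjacency_matrix:
  "simple_graph E \<Longrightarrow> transpose (adjacency_matrix E) = adjacency_matrix E"
  by (auto simp: simple_graph_def adjacency_matrix_def transpose_def vec_eq_iff symp_def)

lemma transpose_sombor_matrix:
  "simple_graph E \<Longrightarrow> transpose (sombor_matrix E) = sombor_matrix E"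
  by (auto simp: simple_graph_def sombor_matrix_def transpose_def vec_eq_iff symp_def add.commute)

lemma min_degree_le: "min_degree E \<le> vertex_degree E v"
  by (simp add: min_degree_def)

lemma max_degree_ge: "vertex_degree E v \<le> max_degree E"
  by (simp add: max_degree_def)

text \<open>Moving the factor under the root gives the entries the shape of Sombor entries, so that
  comparing them reduces to comparing degrees.\<close>

lemma scaled_adjacency_matrix_nth:
  "((sqrt 2 * real k) *\<^sub>R adjacency_matrix E) $ i $ j
    = (if E i j then sqrt ((real k)\<^sup>2 + (real k)\<^sup>2) else 0)"
  by (simp add: adjacency_matrix_def real_sqrt_mult)

lemma min_degree_adjacency_le_sombor:
  "((sqrt 2 * real (min_degree E)) *\<^sub>R adjacency_matrix E) $ i $ j \<le> sombor_matrix E $ i $ j"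
proof -
  have "(real (min_degree E))\<^sup>2 \<le> (real (vertex_degree E v))\<^sup>2" for v
    by (simp add: min_degree_le power_mono)
  from add_mono[OF this[of i] this[of j]] show ?thesis
    unfolding scaled_adjacency_matrix_nth by (simp add: sombor_matrix_def)
qed

lemma sombor_le_max_degree_adjacency:
  "sombor_matrix E $ i $ j \<le> ((sqrt 2 * real (max_degree E)) *\<^sub>R adjacency_matrix E) $ i $ j"
proof -
  have "(real (vertex_degree E v))\<^sup>2 \<le> (real (max_degree E))\<^sup>2" for v
    by (simp add: max_degree_ge power_mono)
  from add_mono[OF this[of i] this[of j]] show ?thesis
    unfolding scaled_adjacency_matrix_nth by (simp add: sombor_matrix_def)
qed

text \<open>Both squares under the root are at least the square of the minimum degree, so equal sums
  force equal summands.\<close>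

lemma sombor_entry_eq_min_degree:
  assumes "E i j"
    and "((sqrt 2 * real (min_degree E)) *\<^sub>R adjacency_matrix E) $ i $ j = sombor_matrix E $ i $ j"
  shows "vertex_degree E i = min_degree E"
proof -
  have "(min_degree E)\<^sup>2 \<le> (vertex_degree E i)\<^sup>2" "(min_degree E)\<^sup>2 \<le> (vertex_degree E j)\<^sup>2"
    by (simp_all add: min_degree_le power_mono)
  moreover have "real ((min_degree E)\<^sup>2 + (min_degree E)\<^sup>2)
      = real ((vertex_degree E i)\<^sup>2 + (vertex_degree E j)\<^sup>2)"
    using assms unfolding scaled_adjacency_matrix_nth by (simp add: sombor_matrix_def)
  then have "(min_degree E)\<^sup>2 + (min_degree E)\<^sup>2 = (vertex_degree E i)\<^sup>2 + (vertex_degree E j)\<^sup>2"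
    using of_nat_eq_iff by blast
  ultimately have "(vertex_degree E i)\<^sup>2 = (min_degree E)\<^sup>2" by linarith
  then show ?thesis by simp
qed

lemma sombor_entry_eq_max_degree:
  assumes "E i j"
    and "sombor_matrix E $ i $ j = ((sqrt 2 * real (max_degree E)) *\<^sub>R adjacency_matrix E) $ i $ j"
  shows "vertex_degree E i = max_degree E"
proof -
  have "(vertex_degree E i)\<^sup>2 \<le> (max_degree E)\<^sup>2" "(vertex_degree E j)\<^sup>2 \<le> (max_degree E)\<^sup>2"
    by (simp_all add: max_degree_ge power_mono)
  moreover have "real ((max_degree E)\<^sup>2 + (max_degree E)\<^sup>2)
      = real ((vertex_degree E i)\<^sup>2 + (vertex_degree E j)\<^sup>2)"
    using assms unfolding scaled_adjacency_matrix_nth by (simp add: sombor_matrix_def)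
  then have "(max_degree E)\<^sup>2 + (max_degree E)\<^sup>2 = (vertex_degree E i)\<^sup>2 + (vertex_degree E j)\<^sup>2"
    using of_nat_eq_iff by blast
  ultimately have "(vertex_degree E i)\<^sup>2 = (max_degree E)\<^sup>2" by linarith
  then show ?thesis by simp
qed

section \<open>The cases of equality\<close>

lemma adjacency_matrix_mult_nth: "(adjacency_matrix E *v x) $ i = (\<Sum>j | E i j. x $ j)"
  by (simp add: adjacency_matrix_def matrix_vector_mult_def if_distrib[of "\<lambda>a. a * _"]
      sum.If_cases cong: if_cong)

text \<open>The Rayleigh quotient of the all-ones vector is the average degree.\<close>

lemma sum_degrees_le_largest_eigenvalue:
  fixes E :: "'n::finite \<Rightarrow> 'n \<Rightarrow> bool"
  assumes "simple_graph E"
  shows "(\<Sum>v\<in>UNIV. real (vertex_degree E v)) \<le> largest_eigenvalue (adjacency_matrix E) * CARD('n)"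
  using rayleigh_le_largest_eigenvalue[OF transpose_adjacency_matrix[OF assms], of "\<chi> i. 1"]
  by (simp add: inner_vec_def adjacency_matrix_mult_nth vertex_degree_def)

text \<open>The average degree is then at most the minimum degree, so the nonnegative deviations
  from the minimum sum to zero.\<close>

lemma largest_eigenvalue_le_min_degree_imp_regular:
  fixes E :: "'n::finite \<Rightarrow> 'n \<Rightarrow> bool"
  assumes "simple_graph E" and le: "largest_eigenvalue (adjacency_matrix E) \<le> real (min_degree E)"
  shows "regular_graph E"
proof -
  have "(\<Sum>v\<in>UNIV. real (vertex_degree E v)) \<le> real (min_degree E) * CARD('n)"
    using mult_right_mono[OF le, of "real CARD('n)"]
    by (intro order_trans[OF sum_degrees_le_largest_eigenvalue[OF assms(1)]]) simp
  then have "(\<Sum>v\<in>UNIV. real (vertex_degree E v) - real (min_degree E)) \<le> 0"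
    by (simp add: sum_subtractf mult.commute)
  then have "(\<Sum>v\<in>UNIV. real (vertex_degree E v) - real (min_degree E)) = 0"
    by (intro antisym sum_nonneg) (simp_all add: min_degree_le)
  then have "\<forall>v. vertex_degree E v = min_degree E"
    by (subst (asm) sum_nonneg_eq_0_iff) (simp_all add: min_degree_le)
  then show ?thesis by (auto simp: regular_graph_def)
qed

text \<open>The eigenvector may vanish on whole components, so entries are compared only on its
  support; a single vertex \<open>i\<close> with the largest entry suffices to bound the
  eigenvalue.\<close>

lemma lower_equality_imp_regular:
  fixes E :: "'n::finite \<Rightarrow> 'n \<Rightarrow> bool"
  assumes G: "simple_graph E"
    and eq: "sqrt 2 * real (min_degree E) * largest_eigenvalue (adjacency_matrix E)
      = largest_eigenvalue (sombor_matrix E)"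
  shows "regular_graph E"
proof -
  let ?A = "adjacency_matrix E" and ?S = "sombor_matrix E" and ?d = "min_degree E"
  let ?l = "largest_eigenvalue ?A"
  note symA = transpose_adjacency_matrix[OF G] and symS = transpose_sombor_matrix[OF G]
  have A_nonneg: "?A $ i $ j \<ge> 0" for i j by (simp add: adjacency_matrix_def)
  obtain x where x: "x \<noteq> 0" "\<And>i. x $ i \<ge> 0" "?A *v x = ?l *\<^sub>R x"
    by (rule nonneg_top_eigenvector[OF symA A_nonneg]) blast
  define m where "m = Max (range (\<lambda>i. x $ i))"
  have le_m: "x $ i \<le> m" for i by (simp add: m_def)
  have "m \<in> range (\<lambda>i. x $ i)" unfolding m_def by (intro Max_in) auto
  then obtain i where i: "x $ i = m" by auto
  have "m > 0"
  proof -
    obtain k where "x $ k \<noteq> 0" using x(1) by (auto simp: vec_eq_iff)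
    then show ?thesis using x(2)[of k] le_m[of k] by linarith
  qed
  have sum: "?l * m = (\<Sum>j | E i j. x $ j)"
    using arg_cong[OF x(3), of "\<lambda>y. y $ i"] by (simp add: adjacency_matrix_mult_nth i)
  \<comment> \<open>If \<open>i\<close> has a neighbour in the support, that edge forces
    \<open>i\<close> to have minimum degree, and row \<open>i\<close> sums at most that many
    entries, each at most \<open>m\<close>. Otherwise row \<open>i\<close> sums to at most
    0.\<close>
  have "?l \<le> ?d"
  proof (cases "\<exists>j. E i j \<and> x $ j > 0")
    case True
    then obtain j where j: "E i j" "x $ j > 0" by auto
    let ?c = "sqrt 2 * real ?d"
    have scale: "largest_eigenvalue (?c *\<^sub>R ?A) = ?c * ?l"
      by (rule largest_eigenvalue_scaleR[OF symA]) simp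
    have "(?c *\<^sub>R ?A) $ i $ j = ?S $ i $ j"
    proof (rule largest_eigenvalue_eq_imp_entries_eq[OF symS min_degree_adjacency_le_sombor _ x(2)])
      show "largest_eigenvalue (?c *\<^sub>R ?A) = largest_eigenvalue ?S" using scale eq by simp
      show "?c *\<^sub>R ?A *v x = largest_eigenvalue (?c *\<^sub>R ?A) *\<^sub>R x"
        by (simp add: scale scaleR_matrix_vector_assoc[symmetric] x(3))
    qed (use i j \<open>m > 0\<close> in auto)
    then have deg: "vertex_degree E i = ?d" using sombor_entry_eq_min_degree j(1) by metis
    have "?l * m \<le> (\<Sum>j | E i j. m)" unfolding sum by (intro sum_mono le_m)
    then have "?l * m \<le> ?d * m" using deg by (simp add: vertex_degree_def)
    then show ?thesis using \<open>m > 0\<close> by simp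
  next
    case False
    then have "?l * m \<le> 0" unfolding sum by (intro sum_nonpos) (auto simp: not_less)
    then have "?l \<le> 0" using \<open>m > 0\<close> by (simp add: mult_le_0_iff)
    then show ?thesis by linarith
  qed
  then show ?thesis by (rule largest_eigenvalue_le_min_degree_imp_regular[OF G])
qed

lemma connected_upper_equality_imp_regular:
  fixes E :: "'n::finite \<Rightarrow> 'n \<Rightarrow> bool"
  assumes G: "simple_graph E" and conn: "connected_graph E"
    and eq: "largest_eigenvalue (sombor_matrix E)
      = sqrt 2 * real (max_degree E) * largest_eigenvalue (adjacency_matrix E)"
  shows "regular_graph E"
proof -
  let ?A = "adjacency_matrix E" and ?S = "sombor_matrix E"
  let ?c = "sqrt 2 * real (max_degree E)"
  note symA = transpose_adjacency_matrix[OF G] and symS = transpose_sombor_matrix[OF G]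
  have S_nonneg: "?S $ i $ j \<ge> 0" for i j by (simp add: sombor_matrix_def)
  obtain x where x: "x \<noteq> 0" "\<And>i. x $ i \<ge> 0" "?S *v x = largest_eigenvalue ?S *\<^sub>R x"
    by (rule nonneg_top_eigenvector[OF symS S_nonneg]) blast
  \<comment> \<open>At a zero entry, row \<open>i\<close> of the eigenvalue equation is a vanishing
    sum of nonnegative terms, and the Sombor entry of an edge is nonzero. Zeros thus spread along
    edges, and connectedness would make \<open>x\<close> zero.\<close>
  have zero_step: "x $ j = 0" if "x $ i = 0" "E i j" for i j
  proof -
    have "(\<Sum>j\<in>UNIV. ?S $ i $ j * x $ j) = 0"
      using arg_cong[OF x(3), of "\<lambda>y. y $ i"] that(1) by (simp add: matrix_vector_mult_def)
    then have "?S $ i $ j * x $ j = 0"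
      by (subst (asm) sum_nonneg_eq_0_iff) (simp_all add: S_nonneg x(2))
    moreover have "vertex_degree E i \<noteq> 0" using that(2) by (auto simp: vertex_degree_def)
    then have "?S $ i $ j \<noteq> 0" using that(2) by (simp add: sombor_matrix_def sum_power2_eq_zero_iff)
    ultimately show ?thesis by simp
  qed
  have pos: "x $ i > 0" for i
  proof (rule ccontr)
    assume "\<not> x $ i > 0"
    then have i: "x $ i = 0" using x(2)[of i] by simp
    have "x $ j = 0" for j
    proof -
      have "E\<^sup>*\<^sup>* i j" using conn by (simp add: connected_graph_def)
      then show ?thesis by (induction rule: rtranclp_induct) (auto simp: i zero_step)
    qed
    then show False using x(1) by (simp add: vec_eq_iff)
  qed
  have edge: "vertex_degree E i = max_degree E" if "E i j" for i j
  proof (rule sombor_entry_eq_max_degree[of E, OF that])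
    show "?S $ i $ j = (?c *\<^sub>R ?A) $ i $ j"
    proof (rule largest_eigenvalue_eq_imp_entries_eq[OF _ sombor_le_max_degree_adjacency _ x(2,3) pos pos])
      show "transpose (?c *\<^sub>R ?A) = ?c *\<^sub>R ?A" by (simp add: transpose_scalar symA)
      show "largest_eigenvalue ?S = largest_eigenvalue (?c *\<^sub>R ?A)"
        using largest_eigenvalue_scaleR[OF symA, of ?c] eq by simp
    qed
  qed
  \<comment> \<open>The fact \<open>edge\<close> speaks only of vertices with a neighbour; a
    connected graph with an isolated vertex has just that one vertex.\<close>
  show ?thesis
  proof (cases "\<forall>v. \<exists>w. E v w")
    case True
    then show ?thesis using edge by (auto simp: regular_graph_def)
  next
    case False
    then obtain v where v: "\<And>w. \<not> E v w" by auto
    have "w = v" for w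
      using conn v by (metis connected_graph_def converse_rtranclpE)
    then show ?thesis by (metis regular_graph_def)
  qed
qed

lemma regular_imp_min_degree_eq_max_degree: "regular_graph E \<Longrightarrow> min_degree E = max_degree E"
  by (auto simp: regular_graph_def min_degree_def max_degree_def image_def)

text \<open>Equality on the upper side alone is characterized for connected graphs: a single edge
  together with an isolated vertex attains the upper bound without being regular.\<close>

theorem theorem3p1:
  fixes E :: "'n::finite \<Rightarrow> 'n \<Rightarrow> bool"
    and \<Delta> \<delta> :: nat
    and lam1 rho1 :: real
  assumes "simple_graph E"
    and "\<Delta> = max_degree E"
    and "\<delta> = min_degree E"
    and "lam1 = largest_eigenvalue (adjacency_matrix E)"
    and "rho1 = largest_eigenvalue (sombor_matrix E)"
  shows "sqrt 2 * real \<delta> * lam1 \<le> rho1 \<and> rho1 \<le> sqrt 2 * real \<Delta> * lam1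
    \<and> (sqrt 2 * real \<delta> * lam1 = rho1 \<and> rho1 = sqrt 2 * real \<Delta> * lam1 \<longleftrightarrow> regular_graph E)
    \<and> (sqrt 2 * real \<delta> * lam1 = rho1 \<longleftrightarrow> regular_graph E)
    \<and> (connected_graph E \<longrightarrow> (rho1 = sqrt 2 * real \<Delta> * lam1 \<longleftrightarrow> regular_graph E))"
proof -
  note G = assms(1)
  note symA = transpose_adjacency_matrix[OF G] and symS = transpose_sombor_matrix[OF G]
  have scale: "largest_eigenvalue ((sqrt 2 * real k) *\<^sub>R adjacency_matrix E) = sqrt 2 * real k * lam1"
    and sym: "transpose ((sqrt 2 * real k) *\<^sub>R adjacency_matrix E) = (sqrt 2 * real k) *\<^sub>R adjacency_matrix E"
    for k
    using largest_eigenvalue_scaleR[OF symA, of "sqrt 2 * real k"]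
    by (simp_all add: assms(4) transpose_scalar symA)
  have lower: "sqrt 2 * real \<delta> * lam1 \<le> rho1"
    unfolding assms(3,5) scale[symmetric]
    by (rule largest_eigenvalue_mono[OF sym symS _ min_degree_adjacency_le_sombor])
      (simp add: adjacency_matrix_def)
  have upper: "rho1 \<le> sqrt 2 * real \<Delta> * lam1"
    unfolding assms(2,5) scale[symmetric]
    by (rule largest_eigenvalue_mono[OF symS sym _ sombor_le_max_degree_adjacency])
      (simp add: sombor_matrix_def)
  \<comment> \<open>With \<open>\<delta> = \<Delta>\<close> the two bounds coincide and squeeze
    \<open>rho1\<close>.\<close>
  have regular: "sqrt 2 * real \<delta> * lam1 = rho1 \<and> rho1 = sqrt 2 * real \<Delta> * lam1" if "regular_graph E"
    using lower upper regular_imp_min_degree_eq_max_degree[OF that] assms(2,3) by auto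
  have "regular_graph E" if "sqrt 2 * real \<delta> * lam1 = rho1"
    using lower_equality_imp_regular[OF G] that assms by simp
  moreover have "regular_graph E" if "connected_graph E" "rho1 = sqrt 2 * real \<Delta> * lam1"
    using connected_upper_equality_imp_regular[OF G] that assms by simp
  ultimately show ?thesis using lower upper regular by blast
qed

end
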